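(* Let $K$ be a field and let $A=\{x_i\mid i\in I\}$ be a well-ordered set, where $I$ is ordered so that $x_i>x_j$ if and only if $i>j$. Let $A^*$ be equipped with the deg-lex order. Let $S\subseteq K\langle A\rangle$ be the set consisting of the following polynomials: \begin{enumerate} \item[1.] $x_ix_jx_k-x_jx_ix_k$ for all $i>j>k$ in $I$, \item[2.] $x_ix_kx_j-x_jx_ix_k$ for all $i>j>k$ in $I$, \item[3.] $x_ix_jx_j-x_jx_ix_j$ for all $i>j$ in $I$, \item[4.] $x_ix_ix_j-x_ix_jx_i$ for all $i>j$ in $I$, \item[5.] $x_ix_jx_ix_k-x_ix_kx_ix_j$ for all $i>j>k$ in $I$. \end{enumerate} Then $S$ is a Gröbner-Shirshov basis of the Chinese monoid $CH(A)$.
   Context: $A^*$ is the free monoid on $A$ (empty word $=1$), $|w|$ is the length of a word $w$, and $K\langle A\rangle$ is the free associative algebra over $K$ generated by $A$. The deg-lex order on $A^*$ compares two words first by length and then, if the lengths are equal, lexicographically from the left using the order of $A$. The Chinese monoid $CH(A)$ is the quotient of $A^*$ by the congruence generated by the set $T$ of relations: $x_ix_jx_k=x_ix_kx_j=x_jx_ix_k$ for all $i>j>k$; and $x_ix_jx_j=x_jx_ix_j$, $x_ix_ix_j=x_ix_jx_i$ for all $i>j$. For a nonzero $f\in K\langle A\rangle$, $\bar f$ denotes its leading (largest) word; $f$ is monic if the coefficient of $\bar f$ in $f$ is $1$. For monic $f,g$ there are two kinds of compositions: (1) if $w$ is a word with $w=\bar f b=a\bar g$ for some $a,b\in A^*$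 and $|\bar f|+|\bar g|>|w|$, the intersection composition is $(f,g)_w=fb-ag$; (2) if $w=\bar f=a\bar g b$ for some $a,b\in A^*$, the inclusion composition is $(f,g)_w=f-agb$. For a set $S$ of monic polynomials, a composition $(f,g)_w$ is trivial modulo $(S,w)$ if $(f,g)_w=\sum\alpha_i a_is_ib_i$ (finite sum) with $\alpha_i\in K$, $a_i,b_i\in A^*$, $s_i\in S$ and $a_i\overline{s_i}b_i<w$ for each $i$. $S$ is a Gröbner-Shirshov basis (for $K\langle A\mid S\rangle=K\langle A\rangle/\mathrm{Id}(S)$, where $\mathrm{Id}(S)$ is the two-sided ideal generated by $S$) if every composition $(f,g)_w$ of polynomials $f,g\in S$ is trivial modulo $(S,w)$. A set $S$ of polynomials of the form $u-v$ with $u,v\in A^*$ is called a Gröbner-Shirshov basis of a monoid $M$ generated by $A$ if $S$ is a Gröbner-Shirshov basis for $K\langle A\mid S\rangle$ (that is, every composition $(f,g)_w$ of polynomials $f,g\in S$ is trivial modulo $(S,w)$) and $M$ is presented by $A$ with the relations $u=v$ for $u-v\in S$ (that is, $M$ is the quotient of $A^*$ by the congruence generated by these relations). *)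

theory Defs
  imports "HOL-Library.Poly_Mapping" "HOL-Algebra.Group"
begin

section \<open>Words and the free associative algebra\<close>

text \<open>
  The free monoid on \<^typ>\<open>'a\<close> is \<^typ>\<open>'a list\<close> with concatenation. The
  product on \<^typ>\<open>'b \<Rightarrow>\<^sub>0 'k\<close> in \<^theory>\<open>HOL-Library.Poly_Mapping\<close> is the convolution product of
  an \<^emph>\<open>additively\<close> written (not necessarily commutative) monoid of exponents, so concatenation has to
  be registered as addition; the free associative algebra is then the monoid algebra
  \<^typ>\<open>'a list \<Rightarrow>\<^sub>0 'k\<close>.
\<close>

instantiation list :: (type) monoid_add
begin

definition zero_list :: "'a list" where "zero_list = []"

definition plus_list :: "'a list \<Rightarrow> 'a list \<Rightarrow> 'a list" where "plus_list u v = u @ v"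

instance
  by standard (simp_all add: zero_list_def plus_list_def)

end

type_synonym ('a, 'k) free_algebra = "'a list \<Rightarrow>\<^sub>0 'k"

definition word :: "'a list \<Rightarrow> ('a, 'k::field) free_algebra" where
  "word u = Poly_Mapping.single u 1"

lemma word_mult: "word u * word v = word (u @ v)"
  by (simp add: word_def mult_single plus_list_def)

lemma word_Nil: "word [] = 1"
  by (simp add: word_def zero_list_def flip: single_one)

definition deglex :: "'a::wellorder list \<Rightarrow> 'a list \<Rightarrow> bool" where
  "deglex u v \<longleftrightarrow> (u, v) \<in> lenlex {(x, y). x < y}"

text \<open>The leading word is meaningful for nonzero polynomials only.\<close>

definition lead_word :: "('a::wellorder, 'k::field) free_algebra \<Rightarrow> 'a list" where
  "lead_word f = (THE w. w \<in> Poly_Mapping.keys f \<and> (\<forall>v\<in>Poly_Mapping.keys f. v \<noteq> w \<longrightarrow> deglex v w))"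

definition monic :: "('a::wellorder, 'k::field) free_algebra \<Rightarrow> bool" where
  "monic f \<longleftrightarrow> f \<noteq> 0 \<and> Poly_Mapping.lookup f (lead_word f) = 1"

lemma deglex_trans: "deglex u v \<Longrightarrow> deglex v w \<Longrightarrow> deglex u w"
  unfolding deglex_def
  by (rule transD[OF lenlex_transI]) (auto intro: transI)

lemma deglex_irrefl: "\<not> deglex u u"
  unfolding deglex_def by (simp add: lenlex_irreflexive)

lemma deglex_total: "u \<noteq> v \<Longrightarrow> deglex u v \<or> deglex v u"
proof -
  have "total {(x, y). x < (y::'a::wellorder)}"
    by (auto simp: total_on_def)
  then have "total (lenlex {(x, y). x < (y::'a::wellorder)})"
    by (rule total_lenlex)
  then show "u \<noteq> v \<Longrightarrow> deglex u v \<or> deglex v u"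
    by (auto simp: deglex_def total_on_def)
qed

lemma lead_word_eqI:
  assumes "w \<in> Poly_Mapping.keys f" and "\<And>v. v \<in> Poly_Mapping.keys f \<Longrightarrow> v \<noteq> w \<Longrightarrow> deglex v w"
  shows "lead_word f = w"
  unfolding lead_word_def
proof (rule the_equality)
  show "w \<in> Poly_Mapping.keys f \<and> (\<forall>v\<in>Poly_Mapping.keys f. v \<noteq> w \<longrightarrow> deglex v w)"
    using assms by simp
next
  fix w' assume w': "w' \<in> Poly_Mapping.keys f \<and> (\<forall>v\<in>Poly_Mapping.keys f. v \<noteq> w' \<longrightarrow> deglex v w')"
  show "w' = w"
  proof (rule ccontr)
    assume "w' \<noteq> w"
    then have "deglex w w'" "deglex w' w" using assms w' by auto
    then show False using deglex_trans deglex_irrefl by metis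
  qed
qed

lemma lead_word_exists:
  assumes "f \<noteq> 0"
  shows "\<exists>w\<in>Poly_Mapping.keys f. \<forall>v\<in>Poly_Mapping.keys f. v \<noteq> w \<longrightarrow> deglex v w"
proof -
  have "\<exists>w\<in>F. \<forall>v\<in>F. v \<noteq> w \<longrightarrow> deglex v w" if "finite F" "F \<noteq> {}" for F :: "'a list set"
    using that
  proof (induction F rule: finite_ne_induct)
    case (insert x F)
    then obtain w where w: "w \<in> F" "\<forall>v\<in>F. v \<noteq> w \<longrightarrow> deglex v w" by blast
    show ?case
    proof (cases "deglex x w")
      case True
      then show ?thesis using w by blast
    next
      case False
      moreover have "x \<noteq> w" using insert.hyps w by blast
      ultimately have "deglex w x" using deglex_total by blast
      then have "\<forall>v\<in>insert x F. v \<noteq> x \<longrightarrow> deglex v x"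
        using w deglex_trans by (metis insertE)
      then show ?thesis by blast
    qed
  qed simp
  with assms show ?thesis by simp
qed

section \<open>Compositions and Groebner-Shirshov bases\<close>

text \<open>\<open>is_composition f g w h\<close>: \<open>h\<close> is a composition of \<open>f\<close> and \<open>g\<close> with respect to \<open>w\<close>. This is a
  relation because the occurrence of the leading word of \<open>g\<close> in an inclusion composition need not be
  unique.\<close>

inductive is_composition ::
  "('a::wellorder, 'k::field) free_algebra \<Rightarrow> ('a, 'k) free_algebra \<Rightarrow> 'a list \<Rightarrow>
   ('a, 'k) free_algebra \<Rightarrow> bool" where
  intersection:
    "w = lead_word f @ b \<Longrightarrow> w = a @ lead_word g \<Longrightarrow>
     length (lead_word f) + length (lead_word g) > length w \<Longrightarrow>
     is_composition f g w (f * word b - word a * g)"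
| inclusion:
    "w = lead_word f \<Longrightarrow> w = a @ lead_word g @ b \<Longrightarrow>
     is_composition f g w (f - word a * g * word b)"

text \<open>Here \<open>single u c\<close> is the scalar multiple of the word \<open>u\<close> by \<open>c\<close>.\<close>

definition trivial_mod ::
  "('a::wellorder, 'k::field) free_algebra set \<Rightarrow> 'a list \<Rightarrow> ('a, 'k) free_algebra \<Rightarrow> bool" where
  "trivial_mod S w h \<longleftrightarrow>
    (\<exists>(n::nat) \<alpha> a s b.
      (\<forall>i<n. s i \<in> S \<and> deglex (a i @ lead_word (s i) @ b i) w) \<and>
      h = (\<Sum>i<n. Poly_Mapping.single (a i) (\<alpha> i) * s i * word (b i)))"

definition GS_basis :: "('a::wellorder, 'k::field) free_algebra set \<Rightarrow> bool" where
  "GS_basis S \<longleftrightarrow>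
    (\<forall>f\<in>S. monic f) \<and>
    (\<forall>f\<in>S. \<forall>g\<in>S. \<forall>w h. is_composition f g w h \<longrightarrow> trivial_mod S w h)"

section \<open>Monoids presented by generators and relations\<close>

inductive_set monoid_cong :: "('a list \<times> 'a list) set \<Rightarrow> ('a list \<times> 'a list) set"
  for R :: "('a list \<times> 'a list) set" where
  base: "(u, v) \<in> R \<Longrightarrow> (u, v) \<in> monoid_cong R"
| refl: "(u, u) \<in> monoid_cong R"
| sym: "(u, v) \<in> monoid_cong R \<Longrightarrow> (v, u) \<in> monoid_cong R"
| trans: "(u, v) \<in> monoid_cong R \<Longrightarrow> (v, w) \<in> monoid_cong R \<Longrightarrow> (u, w) \<in> monoid_cong R"
| mult: "(u, v) \<in> monoid_cong R \<Longrightarrow> (u', v') \<in> monoid_cong R \<Longrightarrow>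
    (u @ u', v @ v') \<in> monoid_cong R"

definition presented_monoid :: "('a list \<times> 'a list) set \<Rightarrow> 'a list set monoid" where
  "presented_monoid R =
    \<lparr>carrier = UNIV // monoid_cong R,
     mult = (\<lambda>X Y. \<Union>x\<in>X. \<Union>y\<in>Y. monoid_cong R `` {x @ y}),
     one = monoid_cong R `` {[]}\<rparr>"

lemma equiv_monoid_cong: "equiv UNIV (monoid_cong R)"
proof (rule equivI)
  show "monoid_cong R \<subseteq> UNIV \<times> UNIV" by simp
  show "refl (monoid_cong R)" by (rule refl_onI) (rule monoid_cong.refl)
  show "sym (monoid_cong R)" by (rule symI) (rule monoid_cong.sym)
  show "trans (monoid_cong R)" by (rule transI) (rule monoid_cong.trans)
qed

lemma presented_monoid_mult_class:
  "monoid_cong R `` {u} \<otimes>\<^bsub>presented_monoid R\<^esub> monoid_cong R `` {v} = monoid_cong R `` {u @ v}"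
proof -
  have *: "monoid_cong R `` {x @ y} = monoid_cong R `` {u @ v}"
    if "x \<in> monoid_cong R `` {u}" "y \<in> monoid_cong R `` {v}" for x y
  proof -
    have "(u @ v, x @ y) \<in> monoid_cong R"
      using that by (intro monoid_cong.mult) simp_all
    then show ?thesis
      using equiv_class_eq[OF equiv_monoid_cong] by metis
  qed
  have "u \<in> monoid_cong R `` {u}" "v \<in> monoid_cong R `` {v}"
    by (simp_all add: monoid_cong.refl)
  then have "(\<Union>x\<in>monoid_cong R `` {u}. \<Union>y\<in>monoid_cong R `` {v}. monoid_cong R `` {x @ y}) =
      (\<Union>x\<in>monoid_cong R `` {u}. \<Union>y\<in>monoid_cong R `` {v}. monoid_cong R `` {u @ v})"
    by (intro SUP_cong HOL.refl *)
  also have "\<dots> = monoid_cong R `` {u @ v}"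
    using \<open>u \<in> _\<close> \<open>v \<in> _\<close> by (metis SUP_const empty_iff)
  finally show ?thesis
    by (simp add: presented_monoid_def)
qed

lemma monoid_presented_monoid: "monoid (presented_monoid R)"
proof -
  have carr: "x \<in> carrier (presented_monoid R) \<longleftrightarrow> (\<exists>u. x = monoid_cong R `` {u})" for x
    by (auto simp: presented_monoid_def quotient_def)
  have one: "\<one>\<^bsub>presented_monoid R\<^esub> = monoid_cong R `` {[]}"
    by (simp add: presented_monoid_def)
  show ?thesis
    by (rule monoidI) (auto simp: carr one presented_monoid_mult_class)
qed

definition binomial_relations :: "('a, 'k::field) free_algebra set \<Rightarrow> ('a list \<times> 'a list) set" where
  "binomial_relations S = {(u, v). word u - word v \<in> S}"

definition GS_basis_of_monoid ::
  "('a::wellorder, 'k::field) free_algebra set \<Rightarrow> 'a list set monoid \<Rightarrow> bool" where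
  "GS_basis_of_monoid S M \<longleftrightarrow>
    (\<forall>f\<in>S. \<exists>u v. f = word u - word v) \<and>
    GS_basis S \<and>
    M = presented_monoid (binomial_relations S)"

section \<open>The Chinese monoid\<close>

text \<open>The generator indexed by \<open>i\<close> is identified with \<open>i\<close> itself, so the alphabet is the
  well-ordered type \<^typ>\<open>'a::wellorder\<close>.\<close>

definition chinese_relations :: "('a::wellorder list \<times> 'a list) set" where
  "chinese_relations =
    {([i, j, k], [i, k, j]) | i j k. i > j \<and> j > k} \<union>
    {([i, k, j], [j, i, k]) | i j k. i > j \<and> j > k} \<union>
    {([i, j, j], [j, i, j]) | i j. i > j} \<union>
    {([i, i, j], [i, j, i]) | i j. i > j}"

definition chinese_monoid :: "'a::wellorder list set monoid" where
  "chinese_monoid = presented_monoid chinese_relations"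

definition chinese_basis :: "('a::wellorder, 'k::field) free_algebra set" where
  "chinese_basis =
    {word [i, j, k] - word [j, i, k] | i j k. i > j \<and> j > k} \<union>
    {word [i, k, j] - word [j, i, k] | i j k. i > j \<and> j > k} \<union>
    {word [i, j, j] - word [j, i, j] | i j. i > j} \<union>
    {word [i, i, j] - word [i, j, i] | i j. i > j} \<union>
    {word [i, j, i, k] - word [i, k, i, j] | i j k. i > j \<and> j > k}"

end

theory Submission
  imports Defs
begin

text \<open>
  Triviality of \<open>p - q\<close> modulo \<open>(S, w)\<close> is an equivalence relation between words \<open>p\<close> and \<open>q\<close> which
  contains all rewriting steps that start below \<open>w\<close>. Hence a composition is trivial as soon as
  the two one-step reducts of the overlap \<open>w\<close> have a common normal form. Whether this happens depends
  only on the relative order of the letters of \<open>w\<close>, and every overlap has at most five distinct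
  letters, so only finitely many words remain, and these are checked by rewriting. The fifth family
  of the basis follows from the Chinese relations by \<open>i(jik) = i(ikj) = (iik)j = (iki)j\<close>.
\<close>

section \<open>Triviality of binomials\<close>

lemma trivial_mod_0: "trivial_mod S w 0"
  unfolding trivial_mod_def by (rule exI[of _ 0]) auto

lemma trivial_mod_add_term:
  assumes "trivial_mod S w h" "s \<in> S" "deglex (a @ lead_word s @ b) w"
  shows "trivial_mod S w (h + Poly_Mapping.single a c * s * word b)"
proof -
  from assms(1) obtain n :: nat and \<alpha> as ss bs
    where *: "\<And>i. i < n \<Longrightarrow> ss i \<in> S \<and> deglex (as i @ lead_word (ss i) @ bs i) w"
      and h: "h = (\<Sum>i<n. Poly_Mapping.single (as i) (\<alpha> i) * ss i * word (bs i))"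
    unfolding trivial_mod_def by blast
  show ?thesis
    unfolding trivial_mod_def
    by (rule exI[of _ "Suc n"], rule exI[of _ "\<alpha>(n := c)"], rule exI[of _ "as(n := a)"],
        rule exI[of _ "ss(n := s)"], rule exI[of _ "bs(n := b)"])
      (use * assms(2,3) in \<open>auto simp: h less_Suc_eq\<close>)
qed

lemma trivial_mod_add:
  assumes "trivial_mod S w g" "trivial_mod S w h"
  shows "trivial_mod S w (g + h)"
proof -
  from assms(2) obtain n :: nat and \<alpha> as ss bs
    where *: "\<And>i. i < n \<Longrightarrow> ss i \<in> S \<and> deglex (as i @ lead_word (ss i) @ bs i) w"
      and h: "h = (\<Sum>i<n. Poly_Mapping.single (as i) (\<alpha> i) * ss i * word (bs i))"
    unfolding trivial_mod_def by blast
  have "trivial_mod S w (g + (\<Sum>i<m. Poly_Mapping.single (as i) (\<alpha> i) * ss i * word (bs i)))"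
    if "m \<le> n" for m
    using that
  proof (induction m)
    case 0
    then show ?case using assms(1) by simp
  next
    case (Suc m)
    then show ?case
      using trivial_mod_add_term[OF Suc.IH, of "ss m" "as m" "bs m" "\<alpha> m"] * by (simp add: add.assoc)
  qed
  then show ?thesis by (simp add: h)
qed

lemma trivial_mod_uminus:
  assumes "trivial_mod S w h"
  shows "trivial_mod S w (- h)"
proof -
  from assms obtain n :: nat and \<alpha> as ss bs
    where *: "\<And>i. i < n \<Longrightarrow> ss i \<in> S \<and> deglex (as i @ lead_word (ss i) @ bs i) w"
      and h: "h = (\<Sum>i<n. Poly_Mapping.single (as i) (\<alpha> i) * ss i * word (bs i))"
    unfolding trivial_mod_def by blast
  show ?thesis
    unfolding trivial_mod_def
    by (rule exI[of _ n], rule exI[of _ "\<lambda>i. - \<alpha> i"], rule exI[of _ as], rule exI[of _ ss],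
        rule exI[of _ bs])
      (use * in \<open>auto simp: h single_uminus simp flip: sum_negf\<close>)
qed

text \<open>Turns joinability into triviality: \<open>g\<close> will be the word that both
  \<open>f\<close> and \<open>h\<close> reduce to.\<close>

lemma trivial_mod_diff:
  assumes "trivial_mod S w (f - g)" "trivial_mod S w (h - g)"
  shows "trivial_mod S w (f - h)"
  using trivial_mod_add[OF assms(1) trivial_mod_uminus[OF assms(2)]] by simp

section \<open>Order and leading words of binomials\<close>

lemma deglex_append:
  assumes "deglex u v" "length u = length v"
  shows "deglex (a @ u @ b) (a @ v @ b)"
  using assms unfolding deglex_def lenlex_conv
  by (auto simp: lex_append_rightI intro!: lex_append_leftI)

lemma keys_word_diff:
  assumes "l \<noteq> r"
  shows "Poly_Mapping.keys (word l - word r :: ('a, 'k::field) free_algebra) = {l, r}"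
  using assms by (auto simp: in_keys_iff lookup_minus word_def lookup_single when_def split: if_splits)

lemma lead_word_diff:
  assumes "deglex r l"
  shows "lead_word (word l - word r :: ('a::wellorder, 'k::field) free_algebra) = l"
proof -
  have "l \<noteq> r" using assms deglex_irrefl by blast
  then show ?thesis
    by (intro lead_word_eqI) (use assms in \<open>auto simp: keys_word_diff\<close>)
qed

lemma monic_word_diff:
  assumes "deglex r l"
  shows "monic (word l - word r :: ('a::wellorder, 'k::field) free_algebra)"
proof -
  have "l \<noteq> r" using assms deglex_irrefl by blast
  then have "(word l - word r :: ('a, 'k) free_algebra) \<noteq> 0"
    using keys_word_diff[of l r, where ?'k = 'k] by auto
  moreover have "Poly_Mapping.lookup (word l - word r :: ('a, 'k) free_algebra) l = 1"
    using \<open>l \<noteq> r\<close> by (simp add: lookup_minus word_def lookup_single)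
  ultimately show ?thesis
    by (simp add: monic_def lead_word_diff[OF assms])
qed

text \<open>Only supports are compared, so signs are lost and the swapped alternative stays; in
  characteristic 2 it does occur.\<close>

lemma word_diff_eqD:
  fixes l r u v :: "'a list"
  assumes "(word u - word v :: ('a, 'k::field) free_algebra) = word l - word r" "l \<noteq> r"
  shows "u = l \<and> v = r \<or> u = r \<and> v = l"
proof -
  have "u \<noteq> v"
    using assms keys_word_diff[OF assms(2), where ?'k = 'k] by auto
  then have "{u, v} = {l, r}"
    using keys_word_diff[of u v, where ?'k = 'k] keys_word_diff[OF assms(2), where ?'k = 'k] assms(1)
    by simp
  then show ?thesis by (auto simp: doubleton_eq_iff)
qed

section \<open>The rewriting system\<close>

text \<open>The first three families of the basis merge into the single rule \<open>A\<close>.\<close>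

inductive chinese_rule :: "'a::linorder list \<Rightarrow> 'a list \<Rightarrow> bool" where
  A: "b < a \<Longrightarrow> c < a \<Longrightarrow> chinese_rule [a, b, c] [max b c, a, min b c]"
| B: "j < i \<Longrightarrow> chinese_rule [i, i, j] [i, j, i]"
| C: "k < j \<Longrightarrow> j < i \<Longrightarrow> chinese_rule [i, j, i, k] [i, k, i, j]"

lemma chinese_basis_eq:
  "(chinese_basis :: ('a::wellorder, 'k::field) free_algebra set) =
     {word l - word r | l r. chinese_rule l r}"
proof (intro equalityI subsetI)
  fix f :: "('a, 'k) free_algebra"
  assume f: "f \<in> chinese_basis"
  have "chinese_rule [i, j, k] [j, i, k]" "chinese_rule [i, k, j] [j, i, k]"
    if "j < i" "k < j" for i j k :: 'a
  proof -
    have "max j k = j" "max k j = j" "min j k = k" "min k j = k" "k < i"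
      using that by auto
    then show "chinese_rule [i, j, k] [j, i, k]" "chinese_rule [i, k, j] [j, i, k]"
      using chinese_rule.A[of j i k] chinese_rule.A[of k i j] that by simp_all
  qed
  moreover have "chinese_rule [i, j, j] [j, i, j]" if "j < i" for i j :: 'a
    using chinese_rule.A[of j i j] that by simp
  ultimately show "f \<in> {word l - word r | l r. chinese_rule l r}"
    using f chinese_rule.B chinese_rule.C unfolding chinese_basis_def by blast
next
  fix f :: "('a, 'k) free_algebra"
  assume "f \<in> {word l - word r | l r. chinese_rule l r}"
  then obtain l r where f: "f = word l - word r" and "chinese_rule l r" by blast
  from this(2) show "f \<in> chinese_basis"
  proof cases
    case (A b a c)
    \<comment> \<open>The comparison of the last two letters tells which of the first three families
      the rule comes from.\<close>
    consider "c < b" | "b < c" | "b = c" using linorder_cases by blast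
    then show ?thesis
    proof cases
      case 1
      then have "f = word [a, b, c] - word [b, a, c]" using A by (auto simp: f max_def min_def)
      then show ?thesis using 1 A(3) unfolding chinese_basis_def by blast
    next
      case 2
      then have "f = word [a, b, c] - word [c, a, b]" using A by (auto simp: f max_def min_def)
      then show ?thesis using 2 A(4) unfolding chinese_basis_def by blast
    next
      case 3
      then have "f = word [a, b, b] - word [b, a, b]" using A by (simp add: f)
      then show ?thesis using A(3) unfolding chinese_basis_def by blast
    qed
  next
    case (B j i)
    then show ?thesis unfolding chinese_basis_def f by blast
  next
    case (C k j i)
    then show ?thesis unfolding chinese_basis_def f by blast
  qed
qed

lemma chinese_rule_length_lhs: "chinese_rule l r \<Longrightarrow> length l \<in> {3, 4}"
  by (induction rule: chinese_rule.induct) simp_all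

lemma chinese_rule_length: "chinese_rule l r \<Longrightarrow> length r = length l"
  by (induction rule: chinese_rule.induct) auto

text \<open>Both sides have equal length, and the first letter that changes gets smaller: the first
  one in \<open>A\<close> (from \<open>a\<close> to \<open>max b c\<close>), the second one in
  \<open>B\<close> and \<open>C\<close>.\<close>

lemma chinese_rule_deglex: "chinese_rule l r \<Longrightarrow> deglex r l"
  unfolding deglex_def by (induction rule: chinese_rule.induct) (unfold Cons_lenlex_iff, simp_all)

lemma chinese_rule_neq: "chinese_rule (l :: 'a::wellorder list) r \<Longrightarrow> l \<noteq> r"
  using chinese_rule_deglex[of l r] deglex_irrefl[of l] by auto

text \<open>The second letter is below the first in \<open>A\<close> and equal to it in
  \<open>B\<close>, and only \<open>C\<close> has length 4. Hence basis elements with the same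
  leading word are equal, and a composition with full overlap is \<open>f - f\<close>.\<close>

lemma chinese_rule_deterministic: "chinese_rule l r \<Longrightarrow> chinese_rule l r' \<Longrightarrow> r = r'"
  by (erule chinese_rule.cases; erule chinese_rule.cases; simp)

section \<open>Executable rewriting\<close>

fun head_reducts :: "'a::linorder list \<Rightarrow> 'a list list" where
  "head_reducts (a # b # c # w) =
     (if b < a \<and> c < a then [max b c # a # min b c # w] else []) @
     (if a = b \<and> c < a then [a # c # a # w] else []) @
     (case w of [] \<Rightarrow> [] | d # v \<Rightarrow> if a = c \<and> d < b \<and> b < a then [a # d # a # b # v] else [])"
| "head_reducts _ = []"

fun reducts :: "'a::linorder list \<Rightarrow> 'a list list" where
  "reducts [] = []"
| "reducts (x # w) = head_reducts (x # w) @ map ((#) x) (reducts w)"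

text \<open>The step count \<open>n\<close> replaces a termination argument. Since
  \<open>reducts\<close> lists positions from left to right, the leftmost redex is rewritten each
  time.\<close>

primrec normalize :: "nat \<Rightarrow> 'a::linorder list \<Rightarrow> 'a list" where
  "normalize 0 w = w"
| "normalize (Suc n) w = (case reducts w of [] \<Rightarrow> w | p # _ \<Rightarrow> normalize n p)"

lemma head_reducts_rule:
  "p \<in> set (head_reducts w) \<longleftrightarrow> (\<exists>l r v. chinese_rule l r \<and> w = l @ v \<and> p = r @ v)"
proof
  assume "p \<in> set (head_reducts w)"
  then show "\<exists>l r v. chinese_rule l r \<and> w = l @ v \<and> p = r @ v"
  proof (induction w rule: head_reducts.induct)
    case (1 a b c w)
    then consider "b < a" "c < a" "p = max b c # a # min b c # w"
      | "a = b" "c < a" "p = a # c # a # w"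
      | d v where "w = d # v" "a = c" "d < b" "b < a" "p = a # d # a # b # v"
      by (auto split: if_splits list.splits)
    then show ?case
    proof cases
      case 1
      then show ?thesis using chinese_rule.A[of b a c] append_Cons append_Nil by metis
    next
      case 2
      then show ?thesis using chinese_rule.B[of c a] append_Cons append_Nil by metis
    next
      case 3
      then show ?thesis using chinese_rule.C[of d b a] append_Cons append_Nil by metis
    qed
  qed auto
next
  assume "\<exists>l r v. chinese_rule l r \<and> w = l @ v \<and> p = r @ v"
  then obtain l r v where "chinese_rule l r" "w = l @ v" "p = r @ v" by blast
  then show "p \<in> set (head_reducts w)"
    by cases simp_all
qed

lemma reducts_rule:
  "p \<in> set (reducts w) \<longleftrightarrow>
     (\<exists>u l r v. chinese_rule l r \<and> w = u @ l @ v \<and> p = u @ r @ v)"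
proof (induction w arbitrary: p)
  case Nil
  have "l \<noteq> []" if "chinese_rule l r" for l r :: "'a list"
    using that by cases simp_all
  then show ?case by auto
next
  case (Cons x w)
  have "(\<exists>u l r v. chinese_rule l r \<and> x # w = u @ l @ v \<and> p = u @ r @ v) \<longleftrightarrow>
      (\<exists>l r v. chinese_rule l r \<and> x # w = l @ v \<and> p = r @ v) \<or>
      (\<exists>p'. p = x # p' \<and> (\<exists>u l r v. chinese_rule l r \<and> w = u @ l @ v \<and> p' = u @ r @ v))"
    (is "?L \<longleftrightarrow> ?R1 \<or> ?R2")
  proof
    assume ?L
    then obtain u l r v where *: "chinese_rule l r" "x # w = u @ l @ v" "p = u @ r @ v" by blast
    show "?R1 \<or> ?R2"
    proof (cases u)
      case Nil
      then show ?thesis using * by auto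
    next
      case (Cons y u')
      then have "p = x # (u' @ r @ v)" "w = u' @ l @ v" using * by auto
      then show ?thesis using *(1) by blast
    qed
  next
    assume "?R1 \<or> ?R2"
    then show ?L
    proof
      assume ?R1
      then show ?L by (metis append_Nil)
    next
      assume ?R2
      then show ?L by (metis append_Cons)
    qed
  qed
  then show ?case
    unfolding reducts.simps set_append Un_iff set_map image_iff head_reducts_rule Bex_def Cons.IH
    by blast
qed

section \<open>Invariance under order-preserving renaming of letters\<close>

lemma head_reducts_map:
  assumes "strict_mono_on X h" "set w \<subseteq> X"
  shows "head_reducts (map h w) = map (map h) (head_reducts w)"
proof -
  have less: "h x < h y \<longleftrightarrow> x < y" and eq: "h x = h y \<longleftrightarrow> x = y" if "x \<in> X" "y \<in> X" for x y
    using assms(1) that by (simp_all add: strict_mono_on_less strict_mono_on_eq)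
  have mm: "max (h x) (h y) = h (max x y)" "min (h x) (h y) = h (min x y)"
    if "x \<in> X" "y \<in> X" for x y
    using that less[of x y] less[of y x] eq[of x y]
    by (auto simp: max_def min_def not_le)
  show ?thesis
    using assms(2) by (induction w rule: head_reducts.induct) (auto simp: less eq mm split: list.split)
qed

lemma reducts_map:
  assumes "strict_mono_on X h" "set w \<subseteq> X"
  shows "reducts (map h w) = map (map h) (reducts w)"
  using assms(2)
proof (induction w)
  case (Cons x w)
  then show ?case
    using head_reducts_map[OF assms(1), of "x # w"] by (simp del: head_reducts.simps)
qed simp

text \<open>Each rule permutes the letters of its left side. This keeps every word of a reduction
  inside the set on which a renaming is monotone.\<close>

lemma set_reducts:
  assumes "p \<in> set (reducts w)"
  shows "set p = set w"
proof -
  have "set r = set l" if "chinese_rule l r" for l r :: "'a list"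
    using that by cases (auto simp: max_def min_def)
  then show ?thesis using assms by (auto simp: reducts_rule)
qed

lemma set_normalize: "set (normalize n w) = set w"
proof (induction n arbitrary: w)
  case (Suc n)
  then show ?case using set_reducts[of _ w] by (auto split: list.split)
qed simp

lemma normalize_map:
  assumes "strict_mono_on X h" "set w \<subseteq> X"
  shows "normalize n (map h w) = map h (normalize n w)"
  using assms(2)
proof (induction n arbitrary: w)
  case (Suc n)
  then show ?case using set_reducts[of _ w]
    by (simp add: reducts_map[OF assms(1)] split: list.split)
qed simp

section \<open>Critical pairs\<close>

text \<open>Ten reduction steps suffice to normalise every overlap of two rules and its reducts; the
  extremal overlap is \<open>ijiklkm\<close> with \<open>i > j > k > l > m\<close>.\<close>

definition resolves :: "'a::linorder list \<Rightarrow> bool" where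
  "resolves w \<longleftrightarrow> (\<forall>p\<in>set (reducts w). normalize 10 p = normalize 10 w)"

text \<open>Reduction commutes with the renaming, so the check on \<open>map h w\<close> yields
  equal images of the two results; \<open>h\<close> is injective on the letters of \<open>w\<close>,
  and reduction creates no new letters, so the results themselves agree.\<close>

lemma resolves_map:
  assumes h: "strict_mono_on (set w) h" and "resolves (map h w)"
  shows "resolves w"
  unfolding resolves_def
proof
  fix p assume p: "p \<in> set (reducts w)"
  then have sp: "set p = set w" by (rule set_reducts)
  from p have "map h p \<in> set (reducts (map h w))"
    by (simp add: reducts_map[OF h])
  then have "map h (normalize 10 p) = map h (normalize 10 w)"
    using assms(2) sp by (simp add: resolves_def flip: normalize_map[OF h])
  moreover have "inj_on h (set w)" using h by (rule strict_mono_on_imp_inj_on)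
  ultimately show "normalize 10 p = normalize 10 w"
    by (auto simp: inj_on_map_eq_map set_normalize sp)
qed

section \<open>Replacing letters by their ranks\<close>

text \<open>If \<open>x < x'\<close> in \<open>X\<close>, then \<open>x\<close> lies below
  \<open>x'\<close> but not below itself, so the set of smaller elements grows strictly.\<close>

lemma rank_strict_mono_on:
  fixes X :: "'a::linorder set"
  assumes "finite X"
  shows "strict_mono_on X (\<lambda>x. card {y \<in> X. y < x})"
  by (rule strict_mono_onI, rule psubset_card_mono) (use assms in auto)

lemma rank_less_card:
  fixes X :: "'a::linorder set"
  assumes "finite X" "x \<in> X"
  shows "card {y \<in> X. y < x} < card X"
  by (rule psubset_card_mono) (use assms in auto)

text \<open>The possible ranks within a set of at most five elements, as an explicit list for
  evaluation to run through.\<close>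

definition letters :: "nat list" where
  "letters = [0, 1, 2, 3, 4]"

lemma rank_exists:
  fixes X :: "'a::linorder set"
  assumes "finite X" "card X \<le> 5"
  obtains h where "strict_mono_on X h" "\<And>x. x \<in> X \<Longrightarrow> h x \<in> set letters"
proof
  show "strict_mono_on X (\<lambda>x. card {y \<in> X. y < x})"
    using assms(1) by (rule rank_strict_mono_on)
  show "card {y \<in> X. y < x} \<in> set letters" if "x \<in> X" for x
    using rank_less_card[OF assms(1) that] assms(2) by (auto simp: letters_def)
qed

section \<open>Evaluation of the finitely many overlaps\<close>

text \<open>All 625 + 3125 words of these lengths are evaluated, whether or not they are
  overlaps.\<close>

lemma resolves_letters:
  "\<forall>a\<in>set letters. \<forall>b\<in>set letters. \<forall>c\<in>set letters. \<forall>d\<in>set letters. resolves [a, b, c, d]"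
  "\<forall>a\<in>set letters. \<forall>b\<in>set letters. \<forall>c\<in>set letters. \<forall>d\<in>set letters. \<forall>e\<in>set letters.
     resolves [a, b, c, d, e]"
  by code_simp+

text \<open>At lengths 6 and 7 only genuine overlaps are evaluated, with order conditions placed
  early to prune the enumeration. In turn: \<open>A\<close> before \<open>C\<close>,
  \<open>C\<close> before \<open>A\<close>, \<open>B\<close> before \<open>C\<close>,
  \<open>C\<close> before \<open>B\<close>, each sharing one letter; then \<open>C\<close> with
  \<open>C\<close> sharing two letters and sharing one.\<close>

lemma resolves_letters_long:
  "\<forall>i\<in>set letters. \<forall>j\<in>set letters. j < i \<longrightarrow> (\<forall>k\<in>set letters. k < j \<longrightarrow>
     (\<forall>a\<in>set letters. i < a \<longrightarrow> (\<forall>b\<in>set letters. b < a \<longrightarrow> resolves [a, b, i, j, i, k])))"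
  "\<forall>i\<in>set letters. \<forall>j\<in>set letters. j < i \<longrightarrow> (\<forall>k\<in>set letters. k < j \<longrightarrow>
     (\<forall>b\<in>set letters. b < k \<longrightarrow> (\<forall>c\<in>set letters. c < k \<longrightarrow> resolves [i, j, i, k, b, c])))"
  "\<forall>i\<in>set letters. \<forall>j\<in>set letters. j < i \<longrightarrow> (\<forall>k\<in>set letters. k < j \<longrightarrow>
     (\<forall>m\<in>set letters. m < k \<longrightarrow> resolves [i, i, j, k, j, m]))"
  "\<forall>i\<in>set letters. \<forall>j\<in>set letters. j < i \<longrightarrow> (\<forall>k\<in>set letters. k < j \<longrightarrow>
     (\<forall>m\<in>set letters. m < k \<longrightarrow> resolves [i, j, i, k, k, m]))"
  "\<forall>i\<in>set letters. \<forall>j\<in>set letters. j < i \<longrightarrow> (\<forall>k\<in>set letters. k < j \<longrightarrow>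
     (\<forall>m\<in>set letters. m < k \<longrightarrow> resolves [i, j, i, k, i, m]))"
  "\<forall>i\<in>set letters. \<forall>j\<in>set letters. j < i \<longrightarrow> (\<forall>k\<in>set letters. k < j \<longrightarrow>
     (\<forall>m\<in>set letters. m < k \<longrightarrow> (\<forall>n\<in>set letters. n < m \<longrightarrow> resolves [i, j, i, k, m, k, n])))"
  by code_simp+

lemma card_set_five: "card {a, b, c, d, e} \<le> 5"
  using card_length[of "[a, b, c, d, e]"] by simp

lemma resolves_short:
  fixes w :: "'a::linorder list"
  assumes "length w \<in> {4, 5}"
  shows "resolves w"
proof -
  have "card (set w) \<le> 5" using card_length[of w] assms by auto
  then obtain h where h: "strict_mono_on (set w) h" "\<And>x. x \<in> set w \<Longrightarrow> h x \<in> set letters"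
    using rank_exists by blast
  show ?thesis
  proof (rule resolves_map[OF h(1)])
    consider a b c d where "w = [a, b, c, d]" | a b c d e where "w = [a, b, c, d, e]"
      using assms by (auto simp: numeral_eq_Suc length_Suc_conv)
    then show "resolves (map h w)"
      by cases (use h(2) resolves_letters in simp_all)
  qed
qed

lemma resolves_long:
  fixes i j k a b m n :: "'a::linorder"
  assumes "k < j" "j < i"
  shows "\<lbrakk>b < a; i < a\<rbrakk> \<Longrightarrow> resolves [a, b, i, j, i, k]"
    and "\<lbrakk>m < k; n < k\<rbrakk> \<Longrightarrow> resolves [i, j, i, k, m, n]"
    and "m < k \<Longrightarrow> resolves [i, i, j, k, j, m]"
    and "m < k \<Longrightarrow> resolves [i, j, i, k, k, m]"
    and "m < k \<Longrightarrow> resolves [i, j, i, k, i, m]"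
    and "\<lbrakk>m < k; n < m\<rbrakk> \<Longrightarrow> resolves [i, j, i, k, m, k, n]"
proof -
  obtain h :: "'a \<Rightarrow> nat" where h: "strict_mono_on {a, b, i, j, k} h"
    and hl: "\<And>x. x \<in> {a, b, i, j, k} \<Longrightarrow> h x \<in> set letters"
    using rank_exists[of "{a, b, i, j, k}"] card_set_five[of a b i j k] by blast
  note less = strict_mono_onD[OF h]
  show "resolves [a, b, i, j, i, k]" if "b < a" "i < a"
    by (rule resolves_map[OF monotone_on_subset[OF h]])
      (use assms that hl less in \<open>auto intro!: resolves_letters_long[rule_format]\<close>)
next
  \<comment> \<open>One ranking serves the remaining five patterns; each restricts it to the letters
    that it contains.\<close>
  obtain h :: "'a \<Rightarrow> nat" where h: "strict_mono_on {i, j, k, m, n} h"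
    and hl: "\<And>x. x \<in> {i, j, k, m, n} \<Longrightarrow> h x \<in> set letters"
    using rank_exists[of "{i, j, k, m, n}"] card_set_five[of i j k m n] by blast
  note less = strict_mono_onD[OF h]
  show "resolves [i, j, i, k, m, n]" if "m < k" "n < k"
    by (rule resolves_map[OF monotone_on_subset[OF h]])
      (use assms that hl less in \<open>auto intro!: resolves_letters_long[rule_format]\<close>)
  show "resolves [i, i, j, k, j, m]" if "m < k"
    by (rule resolves_map[OF monotone_on_subset[OF h]])
      (use assms that hl less in \<open>auto intro!: resolves_letters_long[rule_format]\<close>)
  show "resolves [i, j, i, k, k, m]" if "m < k"
    by (rule resolves_map[OF monotone_on_subset[OF h]])
      (use assms that hl less in \<open>auto intro!: resolves_letters_long[rule_format]\<close>)
  show "resolves [i, j, i, k, i, m]" if "m < k"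
    by (rule resolves_map[OF monotone_on_subset[OF h]])
      (use assms that hl less in \<open>auto intro!: resolves_letters_long[rule_format]\<close>)
  show "resolves [i, j, i, k, m, k, n]" if "m < k" "n < m"
    by (rule resolves_map[OF monotone_on_subset[OF h]])
      (use assms that hl less in \<open>auto intro!: resolves_letters_long[rule_format]\<close>)
qed

section \<open>Overlaps of left-hand sides\<close>

text \<open>A proper occurrence would put a left side of \<open>A\<close> or \<open>B\<close> inside
  \<open>[i, j, i, k]\<close>. But \<open>[i, j, i]\<close> does not end below its first letter, and
  in \<open>[j, i, k]\<close> the second letter exceeds the first.\<close>

lemma chinese_rule_infix:
  assumes "chinese_rule l r" "chinese_rule l' r'" "l = a @ l' @ b"
  shows "a = [] \<and> b = []"
  using assms
  by (elim chinese_rule.cases) (auto simp: Cons_eq_append_conv)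

text \<open>Left sides have length 3 or 4, so the offset \<open>length a\<close> is 1, 2 or 3.
  Offset 1 gives total length 4 or 5. Offset 2 exceeds 5 only if \<open>l'\<close> belongs to
  \<open>C\<close>. Offset 3 forces \<open>l\<close> to belong to \<open>C\<close>, and the total
  length is 6 or 7.\<close>

lemma overlap_resolves:
  assumes l: "chinese_rule l r" and l': "chinese_rule l' r'"
    and eq: "l @ b = a @ l'" and a: "a \<noteq> []" "length a < length l"
  shows "resolves (l @ b)"
proof -
  have "length a \<noteq> 0" "length a < 4"
    using a chinese_rule_length_lhs[OF l] by auto
  then have "length a = 1 \<or> length a = 2 \<or> length a = 3"
    by linarith
  then consider x where "a = [x]" | x y where "a = [x, y]" | x y z where "a = [x, y, z]"
    by (auto simp: numeral_eq_Suc length_Suc_conv)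
  then show ?thesis
  proof cases
    case 1
    show ?thesis
      using l l' eq a(2) unfolding 1
      by (elim chinese_rule.cases) (auto intro: resolves_short)
  next
    case 2
    show ?thesis
      using l l' eq a(2) unfolding 2
      by (elim chinese_rule.cases) (auto intro: resolves_short resolves_long)
  next
    case 3
    show ?thesis
      using l l' eq a(2) unfolding 3
      by (elim chinese_rule.cases) (auto intro: resolves_long)
  qed
qed

section \<open>The Groebner-Shirshov basis\<close>

lemma trivial_mod_chinese_step:
  fixes w :: "'a::wellorder list"
  assumes "chinese_rule l r" "deglex (u @ l @ v) w"
  shows "trivial_mod (chinese_basis :: ('a, 'k::field) free_algebra set) w
    (word (u @ l @ v) - word (u @ r @ v))"
proof -
  let ?s = "word l - word r :: ('a, 'k) free_algebra"
  have "?s \<in> chinese_basis" using assms(1) by (auto simp: chinese_basis_eq)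
  moreover have "lead_word ?s = l" using assms(1) by (simp add: lead_word_diff chinese_rule_deglex)
  ultimately have "trivial_mod chinese_basis w (0 + Poly_Mapping.single u 1 * ?s * word v)"
    using assms(2) by (intro trivial_mod_add_term trivial_mod_0) simp_all
  then show ?thesis
    by (simp add: algebra_simps word_mult flip: word_def)
qed

lemma reducts_deglex:
  fixes w :: "'a::wellorder list"
  assumes "p \<in> set (reducts w)"
  shows "deglex p w"
proof -
  obtain u l r v where "chinese_rule l r" "w = u @ l @ v" "p = u @ r @ v"
    using assms unfolding reducts_rule by blast
  then show ?thesis
    by (simp add: deglex_append chinese_rule_deglex chinese_rule_length)
qed

text \<open>The difference telescopes over the reduction steps, and each step starts below
  \<open>w\<close> because reduction descends. This holds for every \<open>n\<close>, whether or not
  the result is irreducible.\<close>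

lemma trivial_mod_normalize:
  fixes w :: "'a::wellorder list"
  assumes "deglex p w"
  shows "trivial_mod (chinese_basis :: ('a, 'k::field) free_algebra set) w
    (word p - word (normalize n p))"
  using assms
proof (induction n arbitrary: p)
  case 0
  then show ?case by (simp add: trivial_mod_0)
next
  case (Suc n)
  show ?case
  proof (cases "reducts p")
    case Nil
    then show ?thesis by (simp add: trivial_mod_0)
  next
    case (Cons q qs)
    then have q: "q \<in> set (reducts p)" by simp
    then have "trivial_mod (chinese_basis :: ('a, 'k) free_algebra set) w (word p - word q)"
      using Suc.prems trivial_mod_chinese_step unfolding reducts_rule by blast
    moreover have "deglex q w"
      using reducts_deglex[OF q] Suc.prems by (rule deglex_trans)
    ultimately show ?thesis
      using trivial_mod_add[OF _ Suc.IH[of q]] Cons by fastforce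
  qed
qed

lemma trivial_mod_resolves:
  fixes w :: "'a::wellorder list"
  assumes "resolves w" "p \<in> set (reducts w)" "q \<in> set (reducts w)"
  shows "trivial_mod (chinese_basis :: ('a, 'k::field) free_algebra set) w (word p - word q)"
proof -
  have "normalize 10 p = normalize 10 q" using assms by (simp add: resolves_def)
  then show ?thesis
    using trivial_mod_normalize[OF reducts_deglex[OF assms(2)], of 10, where ?'k = 'k]
      trivial_mod_normalize[OF reducts_deglex[OF assms(3)], of 10, where ?'k = 'k]
    by (auto intro: trivial_mod_diff)
qed

lemma GS_basis_chinese_basis:
  "GS_basis (chinese_basis :: ('a::wellorder, 'k::field) free_algebra set)"
  unfolding GS_basis_def
proof (intro conjI ballI allI impI)
  fix f :: "('a, 'k) free_algebra" assume "f \<in> chinese_basis"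
  then show "monic f"
    by (auto simp: chinese_basis_eq chinese_rule_deglex monic_word_diff)
next
  fix f g h :: "('a, 'k) free_algebra" and w
  assume fg: "f \<in> chinese_basis" "g \<in> chinese_basis" and comp: "is_composition f g w h"
  obtain l r where f: "f = word l - word r" and l: "chinese_rule l r"
    using fg(1) by (auto simp: chinese_basis_eq)
  obtain l' r' where g: "g = word l' - word r'" and l': "chinese_rule l' r'"
    using fg(2) by (auto simp: chinese_basis_eq)
  have lead: "lead_word f = l" "lead_word g = l'"
    using l l' by (simp_all add: f g lead_word_diff chinese_rule_deglex)
  have same: "f = g" if "l = l'"
    using chinese_rule_deterministic l l' that by (auto simp: f g)
  from comp show "trivial_mod chinese_basis w h"
  proof cases
    case (intersection b a)
    then have w: "w = l @ b" "w = a @ l'" by (simp_all add: lead)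
    then have "length l + length b = length a + length l'" by (metis length_append)
    then have len: "length a < length l"
      using intersection(4) w(1) by (simp add: lead)
    \<comment> \<open>Both products contain the word \<open>w\<close> with coefficient 1; it cancels
      and leaves the two one-step reducts of \<open>w\<close>.\<close>
    have h: "h = word (a @ r') - word (r @ b)"
      using w by (simp add: intersection(1) f g algebra_simps word_mult)
    show ?thesis
    proof (cases "a = []")
      case True
      \<comment> \<open>At offset 0 the word \<open>l\<close> is a prefix of \<open>l'\<close>, so
        the two coincide and the composition is zero.\<close>
      then have "l' = [] @ l @ b" using w by simp
      then have "b = []" using chinese_rule_infix[OF l' l] by blast
      then have "l = l'" using w True by simp
      then show ?thesis
        using same \<open>b = []\<close> True by (simp add: intersection(1) word_Nil trivial_mod_0)
    next
      case False
      then have "resolves w"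
        using overlap_resolves[OF l l' _ False len] w by simp
      moreover have "a @ r' \<in> set (reducts w)"
        unfolding reducts_rule using l' w(2) by (metis append_Nil2)
      moreover have "r @ b \<in> set (reducts w)"
        unfolding reducts_rule using l w(1) by (metis append_Nil)
      ultimately show ?thesis
        unfolding h by (rule trivial_mod_resolves)
    qed
  next
    case (inclusion a b)
    then have "l = a @ l' @ b" by (simp add: lead)
    \<comment> \<open>No left side lies properly inside another, so the only inclusion is that of
      \<open>f\<close> in itself.\<close>
    moreover from this have "a = []" "b = []"
      using chinese_rule_infix[OF l l'] by blast+
    ultimately show ?thesis
      using same by (simp add: inclusion(1) word_Nil trivial_mod_0)
  qed
qed

section \<open>The presentation of the Chinese monoid\<close>

lemma monoid_cong_least:
  assumes "R \<subseteq> monoid_cong R'"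
  shows "monoid_cong R \<subseteq> monoid_cong R'"
proof (rule subrelI)
  fix u v assume "(u, v) \<in> monoid_cong R"
  then show "(u, v) \<in> monoid_cong R'"
  proof induction
    case (base u v)
    then show ?case using assms by blast
  qed (rule monoid_cong.refl | erule monoid_cong.sym | erule (1) monoid_cong.trans |
      erule (1) monoid_cong.mult)+
qed

text \<open>In characteristic 2 the binomial \<open>u - v\<close> coincides with \<open>v - u\<close>, so a rule may also be read
  backwards off the basis.\<close>

lemma binomial_relations_chinese_basis:
  "binomial_relations (chinese_basis :: ('a::wellorder, 'k::field) free_algebra set)
     \<subseteq> {(u, v). chinese_rule u v \<or> chinese_rule v u}"
proof (clarsimp simp: binomial_relations_def chinese_basis_eq)
  fix u v l r :: "'a list"
  assume eq: "(word u - word v :: ('a, 'k) free_algebra) = word l - word r"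
    and l: "chinese_rule l r" and "\<not> chinese_rule v u"
  then show "chinese_rule u v"
    using word_diff_eqD[OF eq chinese_rule_neq[OF l]] by auto
qed

lemma chinese_rule_in_monoid_cong:
  assumes "chinese_rule l r"
  shows "(l, r) \<in> monoid_cong chinese_relations"
  using assms
proof cases
  case (A b a c)
  consider "c < b" | "b < c" | "b = c" using linorder_cases by blast
  then show ?thesis
  proof cases
    case 1
    \<comment> \<open>The first family is reached through the intermediate word
      \<open>[a, c, b]\<close> by two Chinese relations.\<close>
    then have "([a, b, c], [a, c, b]) \<in> chinese_relations" "([a, c, b], [b, a, c]) \<in> chinese_relations"
      using A unfolding chinese_relations_def by blast+
    then have "([a, b, c], [b, a, c]) \<in> monoid_cong chinese_relations"
      by (blast intro: monoid_cong.trans[OF monoid_cong.base monoid_cong.base])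
    then show ?thesis using 1 A by (auto simp: max_def min_def)
  next
    case 2
    then have "([a, b, c], [c, a, b]) \<in> chinese_relations"
      using A unfolding chinese_relations_def by blast
    then show ?thesis using 2 A by (auto simp: max_def min_def intro: monoid_cong.base)
  next
    case 3
    then have "([a, b, b], [b, a, b]) \<in> chinese_relations"
      using A unfolding chinese_relations_def by blast
    then show ?thesis using 3 A by (auto intro: monoid_cong.base)
  qed
next
  case (B j i)
  then show ?thesis
    unfolding chinese_relations_def by (auto intro: monoid_cong.base)
next
  case (C k j i)
  have "([j, i, k], [i, k, j]) \<in> monoid_cong chinese_relations"
    using C by (intro monoid_cong.sym[OF monoid_cong.base]) (auto simp: chinese_relations_def)
  then have "([i] @ [j, i, k], [i] @ [i, k, j]) \<in> monoid_cong chinese_relations"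
    by (intro monoid_cong.mult monoid_cong.refl)
  moreover have "([i, i, k], [i, k, i]) \<in> chinese_relations"
    using less_trans[OF C(3,4)] unfolding chinese_relations_def by blast
  then have "([i, i, k] @ [j], [i, k, i] @ [j]) \<in> monoid_cong chinese_relations"
    by (intro monoid_cong.mult monoid_cong.refl monoid_cong.base)
  ultimately show ?thesis
    using C by (auto intro: monoid_cong.trans)
qed

lemma monoid_cong_chinese_basis:
  "monoid_cong (binomial_relations (chinese_basis :: ('a::wellorder, 'k::field) free_algebra set))
     = monoid_cong chinese_relations"
proof
  show "monoid_cong (binomial_relations (chinese_basis :: ('a, 'k) free_algebra set))
      \<subseteq> monoid_cong chinese_relations"
    using binomial_relations_chinese_basis[where ?'a = 'a and ?'k = 'k]
    by (intro monoid_cong_least) (auto dest: chinese_rule_in_monoid_cong intro: monoid_cong.sym)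
next
  let ?C = "monoid_cong (binomial_relations (chinese_basis :: ('a, 'k) free_algebra set))"
  have basis: "(u, v) \<in> ?C" if "word u - word v \<in> (chinese_basis :: ('a, 'k) free_algebra set)" for u v
    using that by (intro monoid_cong.base) (simp add: binomial_relations_def)
  have ijk: "([i, j, k], [j, i, k]) \<in> ?C" and ikj: "([i, k, j], [j, i, k]) \<in> ?C"
    if "j < i" "k < j" for i j k :: 'a
    by (rule basis; use that in \<open>unfold chinese_basis_def, blast\<close>)+
  have ijj: "([i, j, j], [j, i, j]) \<in> ?C" and iij: "([i, i, j], [i, j, i]) \<in> ?C"
    if "j < i" for i j :: 'a
    by (rule basis; use that in \<open>unfold chinese_basis_def, blast\<close>)+
  \<comment> \<open>The one Chinese relation that is no binomial of the basis; both sides are linked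
    to \<open>[j, i, k]\<close>.\<close>
  have "([i, j, k], [i, k, j]) \<in> ?C" if "j < i" "k < j" for i j k :: 'a
    using ijk[OF that] monoid_cong.sym[OF ikj[OF that]] by (rule monoid_cong.trans)
  with ikj ijj iij have "chinese_relations \<subseteq> ?C"
    unfolding chinese_relations_def by blast
  then show "monoid_cong chinese_relations \<subseteq> ?C"
    by (rule monoid_cong_least)
qed

theorem theorem2p1:
  shows "GS_basis_of_monoid (chinese_basis :: ('a::wellorder, 'k::field) free_algebra set)
           (chinese_monoid :: 'a list set monoid)"
  unfolding GS_basis_of_monoid_def
proof (intro conjI ballI)
  show "\<exists>u v. f = word u - word v" if "f \<in> chinese_basis" for f :: "('a, 'k) free_algebra"
    using that by (auto simp: chinese_basis_eq)
  show "GS_basis (chinese_basis :: ('a, 'k) free_algebra set)"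
    by (rule GS_basis_chinese_basis)
  show "chinese_monoid = presented_monoid (binomial_relations (chinese_basis :: ('a, 'k) free_algebra set))"
    \<comment> \<open>A presented monoid depends on its relations only through the congruence, so
      equal congruences give equality, not just isomorphism.\<close>
    by (simp add: chinese_monoid_def presented_monoid_def monoid_cong_chinese_basis)
qed

end
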